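(* Let users be homogeneous with valuation $\theta_0$, and let $SW_a$ be the maximum (supremum) social welfare obtainable at stable equilibria by applying content restriction. (i) If $c_H<\theta_0(\overline{Q}-\underline{Q})$, it is optimal to choose $a=\overline{a}-\epsilon$ with infinitesimal $\epsilon>0$: as $\epsilon\to0^+$ the stable equilibrium with positive flow on both paths satisfies $\hat{x}_H\to 1/2$, and its social welfare tends to the optimum $SW_a=\theta_0\overline{Q}-c_H$. (ii) If $c_H\ge\theta_0(\overline{Q}-\underline{Q})$, it is optimal to choose $a=1$, and $SW_a=\theta_0\underline{Q}$. Over all parameters and content functions $Q_1$, the content-restriction mechanism for homogeneous users achieves $PoA_a=1/2$.
   Context: A unit mass of non-atomic users of common valuation $\theta_0>0$ chooses between path $H$ (travel cost $c_H>0$) and path $L$ (cost $0$); $x_H$ is the mass on $H$. $Q_1:[0,1]\to[0,\infty)$ is continuous, concave, nondecreasing, $Q_1(0)=0$; $Q(x,1)=Q_1(x)+Q_1(1-x)$ is strictly increasing on $[0,1/2]$ (and symmetric about $1/2$). $\underline{Q}=Q(0,1)$, $\overline{Q}=Q(1/2,1)$, and $\overline{a}=\max\{0,(\theta_0\overline{Q}-c_H)/(\theta_0\overline{Q})\}$. Content-restriction mechanism with coefficient $a\in[0,1]$: $L$-users only get access to the fraction $a$ of the content; payoffs are $u(L,x_H)=a\theta_0Q(x_H,1)$ and $u(H,x_H)=\theta_0Q(x_H,1)-c_H$. With $D=u(H,\cdot)-u(L,\cdot)$, $\hat{x}$ is an equilibrium if $D(\hat{x})\ge0$ when $\hat{x}>0$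 and $D(\hat{x})\le0$ when $\hat{x}<1$; it is stable if $D>0$ just to the left and $D<0$ just to the right of $\hat{x}$ (within $[0,1]$). The social welfare at flow $x$ under coefficient $a$ is $SW_{(a)}(x)=x\,u(H,x)+(1-x)\,u(L,x)$. Let $NE(a)$ be the set of equilibria under $a$. The unrestricted optimum is $SW(x_H^* )=\max_{0\le x\le1}\{\theta_0Q(x,1)-xc_H\}$. The price of anarchy is $$PoA_a=\inf_{\theta_0,Q_1,c_H}\frac{\max_{a}\min_{\hat{x}\in NE(a)}SW_{(a)}(\hat{x})}{SW(x_H^* )}.$$ *)

theory Defs
  imports "HOL-Analysis.Analysis"
begin

text \<open>
  A unit mass of users with common valuation \<open>\<theta>\<close> splits between path \<open>H\<close> (travel cost \<open>c\<close>)
  and path \<open>L\<close> (cost \<open>0\<close>); a flow is the mass \<open>x \<in> [0,1]\<close> on path \<open>H\<close>.  Content functions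
  are total functions on the reals of which only the values on \<open>[0,1]\<close> matter.
\<close>

definition total_content :: "(real \<Rightarrow> real) \<Rightarrow> real \<Rightarrow> real" where
  "total_content Q1 x = Q1 x + Q1 (1 - x)"

definition content_function :: "(real \<Rightarrow> real) \<Rightarrow> bool" where
  "content_function Q1 \<longleftrightarrow>
     continuous_on {0..1} Q1 \<and> concave_on {0..1} Q1 \<and> mono_on {0..1} Q1 \<and>
     (\<forall>x\<in>{0..1}. 0 \<le> Q1 x) \<and> Q1 0 = 0 \<and>
     strict_mono_on {0..1/2} (total_content Q1)"

definition admissible :: "real \<Rightarrow> real \<Rightarrow> (real \<Rightarrow> real) \<Rightarrow> bool" where
  "admissible \<theta> c Q1 \<longleftrightarrow> 0 < \<theta> \<and> 0 < c \<and> content_function Q1"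

definition Q_low :: "(real \<Rightarrow> real) \<Rightarrow> real" where
  "Q_low Q1 = total_content Q1 0"

definition Q_high :: "(real \<Rightarrow> real) \<Rightarrow> real" where
  "Q_high Q1 = total_content Q1 (1/2)"

definition a_bar :: "real \<Rightarrow> real \<Rightarrow> (real \<Rightarrow> real) \<Rightarrow> real" where
  "a_bar \<theta> c Q1 = max 0 ((\<theta> * Q_high Q1 - c) / (\<theta> * Q_high Q1))"

definition payoff_L :: "real \<Rightarrow> (real \<Rightarrow> real) \<Rightarrow> real \<Rightarrow> real \<Rightarrow> real" where
  "payoff_L \<theta> Q1 a x = a * \<theta> * total_content Q1 x"

definition payoff_H :: "real \<Rightarrow> real \<Rightarrow> (real \<Rightarrow> real) \<Rightarrow> real \<Rightarrow> real" where
  "payoff_H \<theta> c Q1 x = \<theta> * total_content Q1 x - c"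

definition payoff_diff :: "real \<Rightarrow> real \<Rightarrow> (real \<Rightarrow> real) \<Rightarrow> real \<Rightarrow> real \<Rightarrow> real" where
  "payoff_diff \<theta> c Q1 a x = payoff_H \<theta> c Q1 x - payoff_L \<theta> Q1 a x"

definition social_welfare :: "real \<Rightarrow> real \<Rightarrow> (real \<Rightarrow> real) \<Rightarrow> real \<Rightarrow> real \<Rightarrow> real" where
  "social_welfare \<theta> c Q1 a x = x * payoff_H \<theta> c Q1 x + (1 - x) * payoff_L \<theta> Q1 a x"

definition NE :: "real \<Rightarrow> real \<Rightarrow> (real \<Rightarrow> real) \<Rightarrow> real \<Rightarrow> real set" where
  "NE \<theta> c Q1 a = {x\<in>{0..1}.
     (0 < x \<longrightarrow> 0 \<le> payoff_diff \<theta> c Q1 a x) \<and> (x < 1 \<longrightarrow> payoff_diff \<theta> c Q1 a x \<le> 0)}"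

text \<open>At the boundary flows \<open>0\<close> and \<open>1\<close> only the side lying inside \<open>[0,1]\<close> is tested.\<close>

definition stable_NE :: "real \<Rightarrow> real \<Rightarrow> (real \<Rightarrow> real) \<Rightarrow> real \<Rightarrow> real set" where
  "stable_NE \<theta> c Q1 a = {x \<in> NE \<theta> c Q1 a.
     (\<forall>\<^sub>F y in at_left x. y \<in> {0..1} \<longrightarrow> 0 < payoff_diff \<theta> c Q1 a y) \<and>
     (\<forall>\<^sub>F y in at_right x. y \<in> {0..1} \<longrightarrow> payoff_diff \<theta> c Q1 a y < 0)}"

text \<open>
  Suprema and infima are taken in \<^typ>\<open>ereal\<close>, so that no equation about them can hold merely
  because of the arbitrary value of an empty or unbounded extremum over the reals.
\<close>

definition SW_restricted :: "real \<Rightarrow> real \<Rightarrow> (real \<Rightarrow> real) \<Rightarrow> ereal" where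
  "SW_restricted \<theta> c Q1 =
     (SUP a\<in>{0..1}. SUP x\<in>stable_NE \<theta> c Q1 a. ereal (social_welfare \<theta> c Q1 a x))"

definition SW_optimum :: "real \<Rightarrow> real \<Rightarrow> (real \<Rightarrow> real) \<Rightarrow> ereal" where
  "SW_optimum \<theta> c Q1 = (SUP x\<in>{0..1}. ereal (\<theta> * total_content Q1 x - x * c))"

text \<open>The worst case is over all equilibria, not only the stable ones.\<close>

definition SW_max_min :: "real \<Rightarrow> real \<Rightarrow> (real \<Rightarrow> real) \<Rightarrow> ereal" where
  "SW_max_min \<theta> c Q1 =
     (SUP a\<in>{0..1}. INF x\<in>NE \<theta> c Q1 a. ereal (social_welfare \<theta> c Q1 a x))"

definition PoA_restriction :: ereal where
  "PoA_restriction =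
     Inf {SW_max_min \<theta> c Q1 / SW_optimum \<theta> c Q1 | \<theta> c Q1. admissible \<theta> c Q1}"

end

theory Submission
  imports Defs
begin

text \<open>
  The total content \<open>T\<close> is symmetric about \<open>1/2\<close>, and the payoff difference under coefficient \<open>a\<close>
  is \<open>(1 - a) \<theta> T - c\<close>.  Its interior zeros come in mirror pairs; the one left of \<open>1/2\<close>
  is unstable, the one right of \<open>1/2\<close> is stable and tends to \<open>1/2\<close> as \<open>a\<close> increases to
  \<open>a_bar\<close>.  Symmetry also makes one of the flows \<open>0\<close>, \<open>1\<close> an equilibrium of welfare at most
  \<open>\<theta> T 0\<close> for every \<open>a\<close>, so the best guaranteed welfare is exactly \<open>\<theta> T 0\<close>, reached at
  \<open>a = 1\<close>.  Monotonicity of \<open>Q1\<close> gives \<open>T \<le> 2 T 0\<close>, hence the ratio is at least \<open>1/2\<close>; the contents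
  \<open>x / (x + t\<^sup>2)\<close> with flow \<open>x = t \<longlongrightarrow> 0\<close> and \<open>\<theta> = c = 1\<close> show that this is sharp.
\<close>

section \<open>Shape of the total content\<close>

lemma total_content_mirror: "total_content Q1 (1 - x) = total_content Q1 x"
  by (simp add: total_content_def)

context
  fixes Q1 :: "real \<Rightarrow> real"
  assumes content: "content_function Q1"
begin

lemma total_content_strict_mono:
  assumes "0 \<le> x" "x < y" "y \<le> 1/2"
  shows "total_content Q1 x < total_content Q1 y"
  using content assms unfolding content_function_def strict_mono_on_def by auto

lemma total_content_strict_antimono:
  assumes "1/2 \<le> x" "x < y" "y \<le> 1"
  shows "total_content Q1 y < total_content Q1 x"
  using total_content_strict_mono[of "1 - y" "1 - x"] assms
  by (simp add: total_content_mirror)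

lemma total_content_le_Q_high:
  assumes "x \<in> {0..1}"
  shows "total_content Q1 x \<le> Q_high Q1"
proof (cases x "1/2 :: real" rule: linorder_cases)
  case equal
  then show ?thesis by (simp only: Q_high_def)
qed (use total_content_strict_mono[of x "1/2"] total_content_strict_antimono[of "1/2" x] assms
      in \<open>auto simp: Q_high_def\<close>)

lemma Q_low_less_Q_high: "Q_low Q1 < Q_high Q1"
  unfolding Q_low_def Q_high_def by (rule total_content_strict_mono) auto

text \<open>Both summands at the flow \<open>1/2\<close> equal \<open>Q1 (1/2)\<close>, which is at
  most \<open>Q1 1\<close>, while \<open>Q1 0 = 0\<close> leaves \<open>Q1 1\<close> alone at the
  flow 0. This factor 2 is the source of the price of anarchy \<open>1/2\<close>.\<close>

lemma Q_high_le: "Q_high Q1 \<le> 2 * Q_low Q1"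
proof -
  have "Q1 (1/2) \<le> Q1 1" "Q1 0 = 0"
    using content unfolding content_function_def mono_on_def by auto
  then show ?thesis by (simp add: Q_high_def Q_low_def total_content_def)
qed

text \<open>Squeezing \<open>Q_low Q1\<close> strictly below \<open>Q_high Q1\<close> and the latter
  below \<open>2 * Q_low Q1\<close> excludes zero content. This later makes the optimum a legitimate
  divisor.\<close>

lemma Q_low_pos: "0 < Q_low Q1"
  using Q_low_less_Q_high Q_high_le by linarith

lemma Q_high_pos: "0 < Q_high Q1"
  using Q_low_pos Q_low_less_Q_high by linarith

lemma continuous_on_total_content: "continuous_on {0..1} (total_content Q1)"
proof -
  have c: "continuous_on {0..1} Q1" using content by (simp add: content_function_def)
  have "continuous_on {0..1} (\<lambda>x. Q1 (1 - x))"
    by (rule continuous_on_compose2[OF c]) (auto intro!: continuous_intros)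
  with c show ?thesis unfolding total_content_def[abs_def] by (intro continuous_intros)
qed

end

section \<open>Welfare at equilibria and its upper bound\<close>

lemma total_content_at_1: "total_content Q1 1 = Q_low Q1"
  using total_content_mirror[of Q1 1] by (simp add: Q_low_def)

lemma payoff_diff_eq: "payoff_diff \<theta> c Q1 a x = (1 - a) * \<theta> * total_content Q1 x - c"
  by (simp add: payoff_diff_def payoff_H_def payoff_L_def algebra_simps)

lemma social_welfare_at_0: "social_welfare \<theta> c Q1 a 0 = a * \<theta> * Q_low Q1"
  by (simp add: social_welfare_def payoff_L_def Q_low_def)

lemma social_welfare_at_1: "social_welfare \<theta> c Q1 a 1 = \<theta> * Q_low Q1 - c"
  by (simp add: social_welfare_def payoff_H_def total_content_at_1)

text \<open>At an interior flow both equilibrium inequalities apply, so users are indifferent and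
  the welfare is the common payoff. Read off on path \<open>H\<close>, it no longer mentions
  \<open>a\<close>.\<close>

lemma social_welfare_interior:
  assumes "x \<in> NE \<theta> c Q1 a" "0 < x" "x < 1"
  shows "social_welfare \<theta> c Q1 a x = \<theta> * total_content Q1 x - c"
proof -
  have "payoff_L \<theta> Q1 a x = payoff_H \<theta> c Q1 x"
    using assms by (simp add: NE_def payoff_diff_def)
  then have "social_welfare \<theta> c Q1 a x = payoff_H \<theta> c Q1 x"
    by (simp add: social_welfare_def algebra_simps)
  then show ?thesis by (simp add: payoff_H_def)
qed

text \<open>The flow 0 is bounded by the first term because \<open>a\<close> is at most 1, the flow
  1 loses \<open>c\<close> against that term, and interior flows are bounded by the second term.
  Which term dominates is the distinction between cases (i) and (ii).\<close>

lemma social_welfare_NE_le: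
  assumes "admissible \<theta> c Q1" "a \<in> {0..1}" "x \<in> NE \<theta> c Q1 a"
  shows "social_welfare \<theta> c Q1 a x \<le> max (\<theta> * Q_low Q1) (\<theta> * Q_high Q1 - c)"
proof -
  have adm: "0 < \<theta>" "0 < c" and cf: "content_function Q1"
    using assms(1) by (auto simp: admissible_def)
  have x: "x \<in> {0..1}" using assms(3) by (simp add: NE_def)
  consider "x = 0" | "x = 1" | "0 < x" "x < 1" using x by force
  then show ?thesis
  proof cases
    case 1
    have "a * (\<theta> * Q_low Q1) \<le> 1 * (\<theta> * Q_low Q1)"
      using assms(2) adm Q_low_pos[OF cf] by (intro mult_right_mono) auto
    with 1 show ?thesis by (simp add: social_welfare_at_0 mult.assoc)
  next
    case 2
    with adm show ?thesis by (simp add: social_welfare_at_1)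
  next
    case 3
    have "\<theta> * total_content Q1 x \<le> \<theta> * Q_high Q1"
      using total_content_le_Q_high[OF cf x] adm by simp
    with 3 show ?thesis using social_welfare_interior[OF assms(3)] by simp
  qed
qed

lemma SW_restricted_le:
  assumes "admissible \<theta> c Q1"
  shows "SW_restricted \<theta> c Q1 \<le> ereal (max (\<theta> * Q_low Q1) (\<theta> * Q_high Q1 - c))"
  unfolding SW_restricted_def
  by (intro SUP_least)
    (use social_welfare_NE_le[OF assms] in \<open>simp add: stable_NE_def del: ereal_max\<close>)

lemma SW_restricted_ge:
  assumes "a \<in> {0..1}" "x \<in> stable_NE \<theta> c Q1 a"
  shows "ereal (social_welfare \<theta> c Q1 a x) \<le> SW_restricted \<theta> c Q1"
  unfolding SW_restricted_def using assms by (meson SUP_upper SUP_upper2)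

section \<open>The coefficient 1 and case (ii)\<close>

lemma NE_unrestricted:
  assumes "0 < c"
  shows "NE \<theta> c Q1 1 = {0}"
  using assms by (auto simp: NE_def payoff_diff_eq)

lemma stable_NE_unrestricted:
  assumes "0 < c"
  shows "stable_NE \<theta> c Q1 1 = {0}"
proof -
  \<comment> \<open>Points just left of 0 lie outside \<open>{0..1}\<close>, so the left-hand test
    is vacuous. The right-hand one holds because the payoff difference is constantly
    \<open>- c\<close>.\<close>
  have "\<forall>\<^sub>F y :: real in at_left 0. y < 0"
    by (simp add: eventually_at_filter)
  then have "\<forall>\<^sub>F y in at_left 0. y \<in> {0..1} \<longrightarrow> 0 < payoff_diff \<theta> c Q1 1 y"
    by (rule eventually_mono) auto
  with assms show ?thesis
    by (auto simp: stable_NE_def NE_unrestricted payoff_diff_eq)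
qed

lemma SW_restricted_unrestricted_optimal:
  assumes "admissible \<theta> c Q1" "\<theta> * (Q_high Q1 - Q_low Q1) \<le> c"
  shows "SW_restricted \<theta> c Q1 = ereal (\<theta> * Q_low Q1)"
proof (rule antisym)
  have "max (\<theta> * Q_low Q1) (\<theta> * Q_high Q1 - c) = \<theta> * Q_low Q1"
    using assms(2) by (simp add: algebra_simps)
  then show "SW_restricted \<theta> c Q1 \<le> ereal (\<theta> * Q_low Q1)"
    using SW_restricted_le[OF assms(1)] by simp
  have "0 \<in> stable_NE \<theta> c Q1 1"
    using assms(1) by (simp add: stable_NE_unrestricted admissible_def)
  from SW_restricted_ge[OF _ this] show "ereal (\<theta> * Q_low Q1) \<le> SW_restricted \<theta> c Q1"
    by (simp add: social_welfare_at_0)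
qed

lemma stable_NE_unrestricted_optimal:
  assumes "admissible \<theta> c Q1" "\<theta> * (Q_high Q1 - Q_low Q1) \<le> c"
  shows "stable_NE \<theta> c Q1 1 \<noteq> {} \<and>
    (\<forall>x\<in>stable_NE \<theta> c Q1 1. ereal (social_welfare \<theta> c Q1 1 x) = SW_restricted \<theta> c Q1)"
proof -
  have "stable_NE \<theta> c Q1 1 = {0}"
    using assms(1) by (intro stable_NE_unrestricted) (simp add: admissible_def)
  then show ?thesis
    by (simp add: SW_restricted_unrestricted_optimal[OF assms] social_welfare_at_0)
qed

section \<open>The stable equilibrium using both paths, and case (i)\<close>

lemma interior_stable_NE:
  assumes cf: "content_function Q1"
    and k: "k = (1 - a) * \<theta>" "0 < k" and low: "k * Q_low Q1 < c" and high: "c < k * Q_high Q1"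
  shows "\<exists>x. 1/2 < x \<and> x < 1 \<and> total_content Q1 x = c / k \<and>
           {y \<in> stable_NE \<theta> c Q1 a. 0 < y \<and> y < 1} = {x}"
proof -
  let ?T = "total_content Q1" and ?D = "payoff_diff \<theta> c Q1 a"
  have D: "?D y = k * ?T y - c" for y by (simp add: payoff_diff_eq k(1))
  \<comment> \<open>The two bounds on \<open>k\<close> place the level \<open>c / k\<close> strictly
    between the values of \<open>?T\<close> at 1 and at \<open>1/2\<close>. The intermediate value
    theorem then gives a zero of \<open>?D\<close> on the decreasing half, away from both
    endpoints.\<close>
  have ck: "Q_low Q1 < c / k" "c / k < Q_high Q1"
    using low high k(2) by (simp_all add: field_simps)
  have "continuous_on {1/2..1} ?T"
    by (rule continuous_on_subset[OF continuous_on_total_content[OF cf]]) auto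
  then obtain x where x: "1/2 \<le> x" "x \<le> 1" "?T x = c / k"
    using IVT2'[of ?T 1 "c / k" "1/2"] ck by (auto simp: total_content_at_1 Q_high_def)
  have "?T x \<noteq> ?T (1/2)" "?T x \<noteq> ?T 1"
    using x(3) ck by (simp_all add: total_content_at_1 Q_high_def)
  then have "x \<noteq> 1/2" "x \<noteq> 1" by blast+
  with x have x': "1/2 < x" "x < 1" by auto
  have Dx: "?D x = 0" using x(3) k(2) by (simp add: D)
  have left: "0 < ?D y" if "1/2 \<le> y" "y < x" for y
  proof -
    have "k * ?T x < k * ?T y"
      using total_content_strict_antimono[OF cf that] x' k(2) by simp
    then show ?thesis using Dx by (simp only: D)
  qed
  have right: "?D y < 0" if "x < y" "y \<le> 1" for y
  proof -
    have "k * ?T y < k * ?T x"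
      using total_content_strict_antimono[OF cf _ that] x' k(2) by simp
    then show ?thesis using Dx by (simp only: D)
  qed
  have "\<forall>\<^sub>F y in at_left x. y \<in> {1/2<..<x}"
    using x' by (intro eventually_at_left_real) auto
  then have evl: "\<forall>\<^sub>F y in at_left x. y \<in> {0..1} \<longrightarrow> 0 < ?D y"
    by (rule eventually_mono) (use left in auto)
  have "\<forall>\<^sub>F y in at_right x. y \<in> {x<..<1}"
    using x' by (intro eventually_at_right_real) auto
  then have evr: "\<forall>\<^sub>F y in at_right x. y \<in> {0..1} \<longrightarrow> ?D y < 0"
    by (rule eventually_mono) (use right in auto)
  have stable: "x \<in> stable_NE \<theta> c Q1 a"
    using evl evr Dx x' by (simp add: stable_NE_def NE_def)
  have unique: "y = x" if y: "y \<in> stable_NE \<theta> c Q1 a" "0 < y" "y < 1" for y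
  proof (cases "y < 1/2")
    case True
    \<comment> \<open>Left of \<open>1/2\<close> the difference \<open>?D\<close> is strictly
      increasing, so a zero there is followed by positive values, against the right-hand stability
      test.\<close>
    have Dy: "?D y = 0" using y by (simp add: stable_NE_def NE_def)
    have "\<forall>\<^sub>F z in at_right y. z \<in> {y<..<1/2}"
      using True by (intro eventually_at_right_real) auto
    moreover have "\<forall>\<^sub>F z in at_right y. z \<in> {0..1} \<longrightarrow> ?D z < 0"
      using y by (simp add: stable_NE_def)
    ultimately have "\<forall>\<^sub>F z in at_right y. z \<in> {y<..<1/2} \<and> ?D z < 0"
      by eventually_elim (use y in auto)
    then obtain z where z: "y < z" "z < 1/2" "?D z < 0"
      using eventually_happens[of _ "at_right y"] by auto
    have "?T y < ?T z" using z y by (intro total_content_strict_mono[OF cf]) auto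
    then have "?D y < ?D z" using k(2) by (simp add: D)
    with z(3) Dy show ?thesis by simp
  next
    case False
    have "?D y = 0" using y by (simp add: stable_NE_def NE_def)
    with False left[of y] right[of y] y show ?thesis
      by (cases y x rule: linorder_cases) auto
  qed
  have "{y \<in> stable_NE \<theta> c Q1 a. 0 < y \<and> y < 1} = {x}"
  proof (intro equalityI subsetI)
    fix y assume "y \<in> {x}"
    then show "y \<in> {y \<in> stable_NE \<theta> c Q1 a. 0 < y \<and> y < 1}"
      using stable x' by simp
  qed (use unique in blast)
  with x(3) x' show ?thesis by (intro exI[of _ x] conjI)
qed

text \<open>At the equilibrium the total content is \<open>c / k\<close>, and this level rises to
  \<open>Q_high Q1\<close> as \<epsilon> decreases to 0. Strict decrease right of \<open>1/2\<close>
  then drives the flow to \<open>1/2\<close>.\<close>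

lemma interior_stable_NE_limit:
  assumes adm: "admissible \<theta> c Q1" and c: "c < \<theta> * (Q_high Q1 - Q_low Q1)"
  shows "\<exists>x :: real \<Rightarrow> real.
            (\<forall>\<^sub>F \<epsilon> in at_right 0.
               a_bar \<theta> c Q1 - \<epsilon> \<in> {0..1} \<and>
               {y \<in> stable_NE \<theta> c Q1 (a_bar \<theta> c Q1 - \<epsilon>). 0 < y \<and> y < 1} = {x \<epsilon>}) \<and>
            (x \<longlongrightarrow> 1/2) (at_right 0) \<and>
            ((\<lambda>\<epsilon>. social_welfare \<theta> c Q1 (a_bar \<theta> c Q1 - \<epsilon>) (x \<epsilon>))
               \<longlongrightarrow> \<theta> * Q_high Q1 - c) (at_right 0)"
proof -
  let ?T = "total_content Q1" and ?a = "\<lambda>\<epsilon>. a_bar \<theta> c Q1 - \<epsilon>"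
  \<comment> \<open>This is \<open>(1 - a) * \<theta>\<close> at
    \<open>a = a_bar \<theta> c Q1 - \<epsilon>\<close>. At \<epsilon> = 0 the payoff difference at
    flow \<open>1/2\<close> vanishes; any positive \<epsilon> makes it positive.\<close>
  define k where "k \<epsilon> = c / Q_high Q1 + \<epsilon> * \<theta>" for \<epsilon>
  have \<theta>: "0 < \<theta>" and c0: "0 < c" and cf: "content_function Q1"
    using adm by (auto simp: admissible_def)
  note Q = Q_high_pos[OF cf] Q_low_pos[OF cf] Q_low_less_Q_high[OF cf]
  \<comment> \<open>Positive low content sharpens the case hypothesis to
    \<open>c < \<theta> * Q_high Q1\<close>, which makes the cutoff at 0 in \<open>a_bar\<close>
    inactive.\<close>
  have "0 < \<theta> * Q_low Q1" using \<theta> Q by simp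
  then have cQ: "c < \<theta> * Q_high Q1" using c by (simp add: algebra_simps)
  have ab: "a_bar \<theta> c Q1 = 1 - c / (\<theta> * Q_high Q1)"
    using cQ c0 \<theta> Q by (simp add: a_bar_def field_simps)
  have ab01: "0 < a_bar \<theta> c Q1" "a_bar \<theta> c Q1 < 1"
    using cQ c0 \<theta> Q by (simp_all add: ab)
  have k: "k \<epsilon> = (1 - ?a \<epsilon>) * \<theta>" for \<epsilon>
    using \<theta> by (simp add: k_def ab field_simps)
  have klim: "(k \<longlongrightarrow> c / Q_high Q1) (at_right 0)"
    unfolding k_def[abs_def] by (auto intro!: tendsto_eq_intros)
  \<comment> \<open>The strict bound holds at the limiting coefficient and therefore persists for
    all small positive \<epsilon>.\<close>
  have "c / Q_high Q1 * Q_low Q1 < c" using Q c0 by (simp add: field_simps)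
  moreover have "((\<lambda>\<epsilon>. k \<epsilon> * Q_low Q1) \<longlongrightarrow> c / Q_high Q1 * Q_low Q1) (at_right 0)"
    by (intro tendsto_intros klim)
  ultimately have "\<forall>\<^sub>F \<epsilon> in at_right 0. k \<epsilon> * Q_low Q1 < c"
    by (rule order_tendstoD(2)[rotated])
  moreover have "\<forall>\<^sub>F \<epsilon> in at_right 0. \<epsilon> \<in> {0<..<a_bar \<theta> c Q1}"
    using ab01 by (intro eventually_at_right_real) auto
  ultimately have good: "\<forall>\<^sub>F \<epsilon> in at_right 0. k \<epsilon> * Q_low Q1 < c \<and> \<epsilon> \<in> {0<..<a_bar \<theta> c Q1}"
    by eventually_elim auto
  define P where "P \<epsilon> x \<longleftrightarrow> 1/2 < x \<and> x < 1 \<and> ?T x = c / k \<epsilon> \<and>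
           {y \<in> stable_NE \<theta> c Q1 (?a \<epsilon>). 0 < y \<and> y < 1} = {x}" for \<epsilon> x
  have PD: "1/2 < x" "x < 1" "?T x = c / k \<epsilon>"
    "{y \<in> stable_NE \<theta> c Q1 (?a \<epsilon>). 0 < y \<and> y < 1} = {x}" if "P \<epsilon> x" for \<epsilon> x
    using that unfolding P_def by blast+
  \<comment> \<open>Where \<open>P \<epsilon>\<close> has no witness the chosen value is arbitrary;
    the limits only see small positive \<epsilon>, for which a witness exists.\<close>
  define x where "x \<epsilon> = (SOME x. P \<epsilon> x)" for \<epsilon>
  have "P \<epsilon> (x \<epsilon>) \<and> ?a \<epsilon> \<in> {0..1}"
    if \<epsilon>: "k \<epsilon> * Q_low Q1 < c \<and> \<epsilon> \<in> {0<..<a_bar \<theta> c Q1}" for \<epsilon>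
  proof
    have "0 < k \<epsilon>" "c < k \<epsilon> * Q_high Q1"
      using \<epsilon> c0 \<theta> Q by (auto simp: k_def add_pos_pos field_simps)
    with \<epsilon> have "\<exists>x. P \<epsilon> x"
      unfolding P_def by (intro interior_stable_NE[OF cf k]) auto
    then show "P \<epsilon> (x \<epsilon>)" unfolding x_def by (rule someI_ex)
    show "?a \<epsilon> \<in> {0..1}" using \<epsilon> ab01 by auto
  qed
  then have P: "\<forall>\<^sub>F \<epsilon> in at_right 0. P \<epsilon> (x \<epsilon>) \<and> ?a \<epsilon> \<in> {0..1}"
    using good by (rule eventually_mono[rotated])
  have "((\<lambda>\<epsilon>. c / k \<epsilon>) \<longlongrightarrow> c / (c / Q_high Q1)) (at_right 0)"
    using c0 Q by (intro tendsto_intros klim) auto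
  then have "((\<lambda>\<epsilon>. c / k \<epsilon>) \<longlongrightarrow> Q_high Q1) (at_right 0)" using c0 by simp
  moreover have "\<forall>\<^sub>F \<epsilon> in at_right 0. c / k \<epsilon> = ?T (x \<epsilon>)"
    using P by eventually_elim (auto dest: PD(3))
  ultimately have Tlim: "((\<lambda>\<epsilon>. ?T (x \<epsilon>)) \<longlongrightarrow> Q_high Q1) (at_right 0)"
    by (rule Lim_transform_eventually)
  have "(x \<longlongrightarrow> 1/2) (at_right 0)"
  proof (rule order_tendstoI)
    fix b :: real assume "b < 1/2"
    show "\<forall>\<^sub>F \<epsilon> in at_right 0. b < x \<epsilon>"
      using P by eventually_elim (use \<open>b < 1/2\<close> PD(1) in fastforce)
  next
    fix b :: real assume b: "1/2 < b"
    \<comment> \<open>Capping at 1 keeps the comparison point inside the interval on which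
      \<open>?T\<close> is known to decrease.\<close>
    define b' where "b' = min b 1"
    have b': "1/2 < b'" "b' \<le> 1" "b' \<le> b" using b by (auto simp: b'_def)
    have "?T b' < Q_high Q1"
      unfolding Q_high_def using b' by (intro total_content_strict_antimono[OF cf]) auto
    with Tlim have "\<forall>\<^sub>F \<epsilon> in at_right 0. ?T b' < ?T (x \<epsilon>)"
      by (rule order_tendstoD)
    with P show "\<forall>\<^sub>F \<epsilon> in at_right 0. x \<epsilon> < b"
    proof eventually_elim
      case (elim \<epsilon>)
      have "\<not> b' \<le> x \<epsilon>"
        using elim(2) PD(2)[of \<epsilon> "x \<epsilon>"] elim(1) b' total_content_strict_antimono[OF cf, of b' "x \<epsilon>"]
        by (cases "x \<epsilon> = b'") auto
      with b' show ?case by simp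
    qed
  qed
  moreover have "((\<lambda>\<epsilon>. social_welfare \<theta> c Q1 (?a \<epsilon>) (x \<epsilon>)) \<longlongrightarrow> \<theta> * Q_high Q1 - c) (at_right 0)"
  proof (rule Lim_transform_eventually)
    show "((\<lambda>\<epsilon>. \<theta> * ?T (x \<epsilon>) - c) \<longlongrightarrow> \<theta> * Q_high Q1 - c) (at_right 0)"
      by (intro tendsto_intros Tlim)
    show "\<forall>\<^sub>F \<epsilon> in at_right 0. \<theta> * ?T (x \<epsilon>) - c = social_welfare \<theta> c Q1 (?a \<epsilon>) (x \<epsilon>)"
      using P
    proof eventually_elim
      case (elim \<epsilon>)
      then have "x \<epsilon> \<in> {y \<in> stable_NE \<theta> c Q1 (?a \<epsilon>). 0 < y \<and> y < 1}"
        using PD(4)[of \<epsilon> "x \<epsilon>"] by blast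
      then show ?case by (subst social_welfare_interior) (auto simp: stable_NE_def)
    qed
  qed
  moreover have "\<forall>\<^sub>F \<epsilon> in at_right 0. ?a \<epsilon> \<in> {0..1} \<and>
      {y \<in> stable_NE \<theta> c Q1 (?a \<epsilon>). 0 < y \<and> y < 1} = {x \<epsilon>}"
    using P by eventually_elim (use PD(4) in blast)
  ultimately show ?thesis by blast
qed

text \<open>The lower bound comes from a limit: each welfare along
  \<open>a_bar \<theta> c Q1 - \<epsilon>\<close> lies below the supremum, hence so does their
  limit.\<close>

lemma SW_restricted_balanced:
  assumes adm: "admissible \<theta> c Q1" and c: "c < \<theta> * (Q_high Q1 - Q_low Q1)"
  shows "SW_restricted \<theta> c Q1 = ereal (\<theta> * Q_high Q1 - c)"
proof (rule antisym)
  have "max (\<theta> * Q_low Q1) (\<theta> * Q_high Q1 - c) = \<theta> * Q_high Q1 - c"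
    using c by (simp add: algebra_simps)
  then show "SW_restricted \<theta> c Q1 \<le> ereal (\<theta> * Q_high Q1 - c)"
    using SW_restricted_le[OF adm] by simp
  obtain x where ev: "\<forall>\<^sub>F \<epsilon> in at_right 0.
               a_bar \<theta> c Q1 - \<epsilon> \<in> {0..1} \<and>
               {y \<in> stable_NE \<theta> c Q1 (a_bar \<theta> c Q1 - \<epsilon>). 0 < y \<and> y < 1} = {x \<epsilon>}"
    and lim: "((\<lambda>\<epsilon>. social_welfare \<theta> c Q1 (a_bar \<theta> c Q1 - \<epsilon>) (x \<epsilon>))
               \<longlongrightarrow> \<theta> * Q_high Q1 - c) (at_right 0)"
    using interior_stable_NE_limit[OF assms] by blast
  have "((\<lambda>\<epsilon>. ereal (social_welfare \<theta> c Q1 (a_bar \<theta> c Q1 - \<epsilon>) (x \<epsilon>)))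
               \<longlongrightarrow> ereal (\<theta> * Q_high Q1 - c)) (at_right 0)"
    using lim by simp
  then show "ereal (\<theta> * Q_high Q1 - c) \<le> SW_restricted \<theta> c Q1"
  proof (rule tendsto_upperbound)
    show "\<forall>\<^sub>F \<epsilon> in at_right 0.
        ereal (social_welfare \<theta> c Q1 (a_bar \<theta> c Q1 - \<epsilon>) (x \<epsilon>)) \<le> SW_restricted \<theta> c Q1"
      using ev by eventually_elim (intro SW_restricted_ge, auto)
  qed simp
qed

section \<open>Guaranteed welfare and the lower bound \<open>1/2\<close>\<close>

lemma SW_max_min_eq:
  assumes "admissible \<theta> c Q1"
  shows "SW_max_min \<theta> c Q1 = ereal (\<theta> * Q_low Q1)"
proof (rule antisym)
  have adm: "0 < \<theta>" "0 < c" and cf: "content_function Q1"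
    using assms by (auto simp: admissible_def)
  show "SW_max_min \<theta> c Q1 \<le> ereal (\<theta> * Q_low Q1)"
    unfolding SW_max_min_def
  proof (rule SUP_least)
    fix a :: real assume a: "a \<in> {0..1}"
    have "\<exists>x\<in>NE \<theta> c Q1 a. social_welfare \<theta> c Q1 a x \<le> \<theta> * Q_low Q1"
    proof (cases "payoff_diff \<theta> c Q1 a 0 \<le> 0")
      case True
      have "a * (\<theta> * Q_low Q1) \<le> 1 * (\<theta> * Q_low Q1)"
        using a adm Q_low_pos[OF cf] by (intro mult_right_mono) auto
      with True show ?thesis
        by (intro bexI[of _ 0]) (simp_all add: social_welfare_at_0 NE_def mult.assoc)
    next
      case False
      \<comment> \<open>The total content agrees at the flows 0 and 1, so the sign of the payoff
        difference carries over.\<close>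
      then have "0 \<le> payoff_diff \<theta> c Q1 a 1"
        by (simp add: payoff_diff_eq total_content_at_1 Q_low_def)
      with adm show ?thesis
        by (intro bexI[of _ 1]) (simp_all add: social_welfare_at_1 NE_def)
    qed
    then show "(INF x\<in>NE \<theta> c Q1 a. ereal (social_welfare \<theta> c Q1 a x)) \<le> ereal (\<theta> * Q_low Q1)"
      by (auto intro: INF_lower2)
  qed
  have "(INF x\<in>NE \<theta> c Q1 1. ereal (social_welfare \<theta> c Q1 1 x)) = ereal (\<theta> * Q_low Q1)"
    using adm by (simp add: NE_unrestricted social_welfare_at_0)
  then show "ereal (\<theta> * Q_low Q1) \<le> SW_max_min \<theta> c Q1"
    unfolding SW_max_min_def by (intro SUP_upper2[of 1]) auto
qed

text \<open>The flow 0 witnesses the lower bound; the upper one drops the travel cost and uses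
  \<open>Q_high_le\<close>. Together they make the optimum a finite real.\<close>

lemma SW_optimum_bounds:
  assumes "admissible \<theta> c Q1"
  shows "ereal (\<theta> * Q_low Q1) \<le> SW_optimum \<theta> c Q1" "SW_optimum \<theta> c Q1 \<le> ereal (2 * (\<theta> * Q_low Q1))"
proof -
  have adm: "0 < \<theta>" "0 < c" and cf: "content_function Q1"
    using assms by (auto simp: admissible_def)
  show "ereal (\<theta> * Q_low Q1) \<le> SW_optimum \<theta> c Q1"
    unfolding SW_optimum_def by (intro SUP_upper2[of 0]) (auto simp: Q_low_def)
  show "SW_optimum \<theta> c Q1 \<le> ereal (2 * (\<theta> * Q_low Q1))"
    unfolding SW_optimum_def
  proof (rule SUP_least)
    fix x :: real assume x: "x \<in> {0..1}"
    have "total_content Q1 x \<le> 2 * Q_low Q1"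
      using total_content_le_Q_high[OF cf x] Q_high_le[OF cf] by simp
    then have "\<theta> * total_content Q1 x \<le> \<theta> * (2 * Q_low Q1)"
      using adm by (intro mult_left_mono) auto
    moreover have "0 \<le> x * c" using x adm by simp
    ultimately show "ereal (\<theta> * total_content Q1 x - x * c) \<le> ereal (2 * (\<theta> * Q_low Q1))"
      by (simp add: algebra_simps)
  qed
qed

lemma ratio_ge_half:
  assumes "admissible \<theta> c Q1"
  shows "1 / 2 \<le> SW_max_min \<theta> c Q1 / SW_optimum \<theta> c Q1"
proof -
  have pos: "0 < \<theta> * Q_low Q1"
    using assms Q_low_pos by (simp add: admissible_def)
  obtain s where s: "SW_optimum \<theta> c Q1 = ereal s" "\<theta> * Q_low Q1 \<le> s" "s \<le> 2 * (\<theta> * Q_low Q1)"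
    using SW_optimum_bounds[OF assms] by (cases "SW_optimum \<theta> c Q1") auto
  have "1 / 2 \<le> \<theta> * Q_low Q1 / s"
    using s pos by (simp add: field_simps)
  then have "ereal (1 / 2) \<le> ereal (\<theta> * Q_low Q1 / s)" by simp
  moreover have "ereal (\<theta> * Q_low Q1 / s) = SW_max_min \<theta> c Q1 / SW_optimum \<theta> c Q1"
    using s pos by (simp add: SW_max_min_eq[OF assms])
  moreover have "ereal (1 / 2) = 1 / 2"
    by (simp add: one_ereal_def)
  ultimately show ?thesis by simp
qed

section \<open>Sharpness through saturating contents\<close>

lemma content_function_saturating:
  fixes d :: real
  assumes d: "0 < d"
  shows "content_function (\<lambda>x. x / (x + d))"
proof -
  let ?Q = "\<lambda>x :: real. x / (x + d)"
  have "continuous_on {0..1} ?Q"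
    using d by (intro continuous_intros) (auto simp: add_nonneg_pos less_imp_neq[THEN not_sym])
  moreover have "concave_on {0..1} ?Q"
  proof -
    have "convex_on {0..1} (\<lambda>x. - ?Q x)"
    proof (rule f''_ge0_imp_convex[where f' = "\<lambda>x. - d / (x + d)^2" and f'' = "\<lambda>x. 2 * d / (x + d)^3"])
      fix x :: real assume "x \<in> {0..1}"
      then have x: "0 < x + d" using d by auto
      show "((\<lambda>x. - ?Q x) has_real_derivative - d / (x + d)^2) (at x)"
        using x by (auto intro!: derivative_eq_intros simp: field_simps power2_eq_square)
      show "((\<lambda>x. - d / (x + d)^2) has_real_derivative 2 * d / (x + d)^3) (at x)"
        using x by (auto intro!: derivative_eq_intros simp: divide_simps) (simp add: power_eq_if)
      show "0 \<le> 2 * d / (x + d)^3" using x d by simp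
    qed simp
    then show ?thesis by (simp add: concave_on_def)
  qed
  moreover have "mono_on {0..1} ?Q"
  proof (rule mono_onI)
    fix x y :: real assume "x \<in> {0..1}" "y \<in> {0..1}" "x \<le> y"
    then show "?Q x \<le> ?Q y" using d by (simp add: frac_le_eq divide_le_0_iff algebra_simps)
  qed
  moreover have "strict_mono_on {0..1/2} (total_content ?Q)"
  proof (rule strict_mono_onI)
    fix x y :: real assume xy: "x \<in> {0..1/2}" "y \<in> {0..1/2}" "x < y"
    \<comment> \<open>Each summand is 1 minus \<open>d\<close> over its denominator, and the two
      denominators add up to the constant \<open>1 + 2 * d\<close>. Monotonicity thus reduces to
      that of the product of the denominators.\<close>
    have T: "total_content ?Q z = 2 - d * (1 + 2 * d) / ((z + d) * (1 - z + d))"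
      if "0 \<le> z" "z \<le> 1/2" for z
    proof -
      have "z + d \<noteq> 0" "1 - z + d \<noteq> 0" using that d by auto
      then show ?thesis by (simp add: total_content_def divide_simps) (simp add: algebra_simps)
    qed
    \<comment> \<open>This is exactly the difference of the products of denominators at
      \<open>y\<close> and at \<open>x\<close>.\<close>
    have "0 < (y - x) * (1 - x - y)" using xy by (intro mult_pos_pos) auto
    then have "(x + d) * (1 - x + d) < (y + d) * (1 - y + d)" by (simp add: algebra_simps)
    moreover have "0 < (x + d) * (1 - x + d)" using xy d by (intro mult_pos_pos) auto
    ultimately have "d * (1 + 2 * d) / ((y + d) * (1 - y + d)) < d * (1 + 2 * d) / ((x + d) * (1 - x + d))"
      using xy d by (intro divide_strict_left_mono mult_pos_pos) auto
    then show "total_content ?Q x < total_content ?Q y"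
      using xy by (simp add: T)
  qed
  ultimately show ?thesis using d by (auto simp: content_function_def)
qed

text \<open>With saturation scale \<open>t^2\<close> far below the flow \<open>t\<close>, path
  \<open>H\<close> collects nearly unit content at the vanishing total cost \<open>t\<close>, and
  path \<open>L\<close> does so too. The optimum is thus at least a quantity tending to 2, while
  \<open>Q_low\<close> stays at most 1.\<close>

lemma PoA_restriction_le_half: "PoA_restriction \<le> ereal (1 / 2)"
proof -
  \<comment> \<open>The unrestricted welfare of the flow \<open>t\<close> for content
    \<open>x / (x + t^2)\<close> and \<theta> = c = 1, with the first fraction cancelled by
    \<open>t\<close> so that the limit at 0 can be computed directly.\<close>
  define f where "f t = 1 / (1 + t) + (1 - t) / (1 - t + t^2) - t" for t :: real
  have flim: "(f \<longlongrightarrow> 2) (at_right 0)"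
    unfolding f_def[abs_def] by (auto intro!: tendsto_eq_intros)
  have bound: "PoA_restriction \<le> ereal (1 / f t)" if t: "0 < t" "t < 1" and f: "0 < f t" for t
  proof -
    let ?Q = "\<lambda>x. x / (x + t^2)"
    have adm: "admissible 1 1 ?Q"
      using content_function_saturating[of "t^2"] t by (simp add: admissible_def)
    have "t + t^2 = t * (1 + t)" by (simp add: power2_eq_square algebra_simps)
    then have T: "total_content ?Q t - t = f t"
      using t by (simp add: f_def total_content_def)
    have "ereal (f t) \<le> SW_optimum 1 1 ?Q"
      unfolding SW_optimum_def T[symmetric] using t by (intro SUP_upper2[of t]) auto
    then obtain s where s: "SW_optimum 1 1 ?Q = ereal s" "f t \<le> s"
      using SW_optimum_bounds[OF adm] by (cases "SW_optimum 1 1 ?Q") auto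
    have low: "0 < Q_low ?Q" "Q_low ?Q \<le> 1"
      using t by (simp_all add: Q_low_def total_content_def add_pos_pos)
    have "PoA_restriction \<le> SW_max_min 1 1 ?Q / SW_optimum 1 1 ?Q"
      unfolding PoA_restriction_def using adm by (intro Inf_lower) blast
    also have "\<dots> = ereal (Q_low ?Q / s)"
      using s f by (simp add: SW_max_min_eq[OF adm])
    also have "\<dots> \<le> ereal (1 / f t)"
      using low s f by (simp add: frac_le)
    finally show ?thesis .
  qed
  have "((\<lambda>t. ereal (1 / f t)) \<longlongrightarrow> ereal (1 / 2)) (at_right 0)"
    by (intro tendsto_intros flim) simp
  then show ?thesis
  proof (rule tendsto_lowerbound)
    have "\<forall>\<^sub>F t in at_right 0. 0 < f t" using flim by (rule order_tendstoD) simp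
    moreover have "\<forall>\<^sub>F t :: real in at_right 0. t \<in> {0<..<1}"
      by (intro eventually_at_right_real) simp
    ultimately show "\<forall>\<^sub>F t in at_right 0. PoA_restriction \<le> ereal (1 / f t)"
      by eventually_elim (simp add: bound)
  qed simp
qed

lemma PoA_restriction_eq: "PoA_restriction = 1 / 2"
proof (rule antisym)
  show "PoA_restriction \<le> 1 / 2"
    using PoA_restriction_le_half by (simp add: one_ereal_def)
  show "1 / 2 \<le> PoA_restriction"
    unfolding PoA_restriction_def by (rule Inf_greatest) (use ratio_ge_half in blast)
qed

theorem theorem2:
  "(\<forall>\<theta> c Q1. admissible \<theta> c Q1 \<longrightarrow>
      (c < \<theta> * (Q_high Q1 - Q_low Q1) \<longrightarrow>
         (\<exists>x :: real \<Rightarrow> real.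
            (\<forall>\<^sub>F \<epsilon> in at_right 0.
               a_bar \<theta> c Q1 - \<epsilon> \<in> {0..1} \<and>
               {y \<in> stable_NE \<theta> c Q1 (a_bar \<theta> c Q1 - \<epsilon>). 0 < y \<and> y < 1} = {x \<epsilon>}) \<and>
            (x \<longlongrightarrow> 1/2) (at_right 0) \<and>
            ((\<lambda>\<epsilon>. social_welfare \<theta> c Q1 (a_bar \<theta> c Q1 - \<epsilon>) (x \<epsilon>))
               \<longlongrightarrow> \<theta> * Q_high Q1 - c) (at_right 0)) \<and>
         SW_restricted \<theta> c Q1 = ereal (\<theta> * Q_high Q1 - c)) \<and>
      (\<theta> * (Q_high Q1 - Q_low Q1) \<le> c \<longrightarrow>
         stable_NE \<theta> c Q1 1 \<noteq> {} \<and>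
         (\<forall>x\<in>stable_NE \<theta> c Q1 1. ereal (social_welfare \<theta> c Q1 1 x) = SW_restricted \<theta> c Q1) \<and>
         SW_restricted \<theta> c Q1 = ereal (\<theta> * Q_low Q1))) \<and>
   PoA_restriction = 1 / 2"
proof (rule conjI[OF _ PoA_restriction_eq], rule allI, rule allI, rule allI, rule impI, rule conjI)
  fix \<theta> c Q1
  assume adm: "admissible \<theta> c Q1"
  note balanced = interior_stable_NE_limit[OF adm] SW_restricted_balanced[OF adm]
  show "c < \<theta> * (Q_high Q1 - Q_low Q1) \<longrightarrow>
         (\<exists>x :: real \<Rightarrow> real.
            (\<forall>\<^sub>F \<epsilon> in at_right 0.
               a_bar \<theta> c Q1 - \<epsilon> \<in> {0..1} \<and>
               {y \<in> stable_NE \<theta> c Q1 (a_bar \<theta> c Q1 - \<epsilon>). 0 < y \<and> y < 1} = {x \<epsilon>}) \<and>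
            (x \<longlongrightarrow> 1/2) (at_right 0) \<and>
            ((\<lambda>\<epsilon>. social_welfare \<theta> c Q1 (a_bar \<theta> c Q1 - \<epsilon>) (x \<epsilon>))
               \<longlongrightarrow> \<theta> * Q_high Q1 - c) (at_right 0)) \<and>
         SW_restricted \<theta> c Q1 = ereal (\<theta> * Q_high Q1 - c)"
    by (rule impI, rule conjI, erule balanced(1), erule balanced(2))
  show "\<theta> * (Q_high Q1 - Q_low Q1) \<le> c \<longrightarrow>
         stable_NE \<theta> c Q1 1 \<noteq> {} \<and>
         (\<forall>x\<in>stable_NE \<theta> c Q1 1. ereal (social_welfare \<theta> c Q1 1 x) = SW_restricted \<theta> c Q1) \<and>
         SW_restricted \<theta> c Q1 = ereal (\<theta> * Q_low Q1)"
    using stable_NE_unrestricted_optimal[OF adm] SW_restricted_unrestricted_optimal[OF adm] by blast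
qed

end
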